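(* Let $n\ge 1$. Then $\operatorname{Ker}\mathcal{E}=\operatorname{Im}\Theta$ as subspaces of $\mathbb{C}[\xi,z]$.
   Context: Here $z=(z_1,\dots,z_n)$ and $\xi=(\xi_1,\dots,\xi_n)$ are commuting free variables and $\partial=(\partial_1,\dots,\partial_n)$ with $\partial_i:=\partial/\partial z_i$. The $\mathbb{C}$-linear map $\mathcal{E}:\mathbb{C}[\xi,z]\to\mathbb{C}[z]$ is defined by $\mathcal{E}(g(\xi)h(z)):=g(\partial)h(z)$ for all $g(\xi)\in\mathbb{C}[\xi]$, $h(z)\in\mathbb{C}[z]$, where $g(\partial)$ is obtained by replacing each $\xi_i$ with $\partial_i$. Put $\Theta_i:=\xi_i-\partial_i$ ($1\le i\le n$), a differential operator of $\mathbb{C}[\xi,z]$, $\Theta:=\{\Theta_1,\dots,\Theta_n\}$, and $\operatorname{Im}\Theta:=\sum_{i=1}^n\Theta_i(\mathbb{C}[\xi,z])$. *)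

theory Defs
  imports Complex_Main "HOL-Library.Poly_Mapping"
begin

text \<open>
  Polynomials over \<open>\<complex>\<close> in commuting variables indexed by \<open>'v\<close> are finitely supported maps from
  exponent vectors to coefficients; multiplication is the convolution product of
  \<^theory>\<open>HOL-Library.Poly_Mapping\<close>.

  For a finite index type \<open>'n\<close> with \<open>n = CARD('n)\<close>, the ring \<open>\<complex>[z]\<close> is \<open>'n cpoly\<close> and \<open>\<complex>[\<xi>, z]\<close> is
  \<open>('n + 'n) cpoly\<close>, where \<open>\<xi>\<^sub>i\<close> is the variable \<open>Inl i\<close> and \<open>z\<^sub>i\<close> is the variable \<open>Inr i\<close>.
\<close>

type_synonym 'v cpoly = "('v \<Rightarrow>\<^sub>0 nat) \<Rightarrow>\<^sub>0 complex"

definition mon :: "('v \<Rightarrow>\<^sub>0 nat) \<Rightarrow> 'v cpoly" where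
  "mon m = Poly_Mapping.single m 1"

definition var :: "'v \<Rightarrow> 'v cpoly" where
  "var v = mon (Poly_Mapping.single v 1)"

definition scale :: "complex \<Rightarrow> 'v cpoly \<Rightarrow> 'v cpoly" where
  "scale c p = Poly_Mapping.single 0 c * p"

text \<open>The \<open>\<complex>\<close>-linear map taking prescribed values on the basis of monomials.\<close>

definition lin_ext :: "(('v \<Rightarrow>\<^sub>0 nat) \<Rightarrow> 'w cpoly) \<Rightarrow> 'v cpoly \<Rightarrow> 'w cpoly" where
  "lin_ext \<phi> p = (\<Sum>m\<in>Poly_Mapping.keys p. scale (Poly_Mapping.lookup p m) (\<phi> m))"

text \<open>In \<open>pdiff\<close>, the truncated exponent \<open>m - 1\<close> at \<open>m = 0\<close> is harmless: its coefficient is \<open>0\<close>.\<close>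

definition pdiff :: "'v \<Rightarrow> 'v cpoly \<Rightarrow> 'v cpoly" where
  "pdiff v = lin_ext (\<lambda>m. scale (of_nat (Poly_Mapping.lookup m v)) (mon (m - Poly_Mapping.single v 1)))"

text \<open>
  \<open>\<partial>\<^sup>\<alpha>\<close>. The order of composition is irrelevant because partial derivatives commute
  (\<open>comp_fun_commute_pdiff_pow\<close> below), so that \<open>fold\<close> has its intended meaning.
\<close>

definition pdiff_pow :: "('n::finite \<Rightarrow>\<^sub>0 nat) \<Rightarrow> 'n cpoly \<Rightarrow> 'n cpoly" where
  "pdiff_pow \<alpha> h = Finite_Set.fold (\<lambda>i. pdiff i ^^ Poly_Mapping.lookup \<alpha> i) h UNIV"

text \<open>\<open>g(\<partial>) h\<close>\<close>

definition diff_op :: "'n::finite cpoly \<Rightarrow> 'n cpoly \<Rightarrow> 'n cpoly" where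
  "diff_op g h = lin_ext (\<lambda>\<alpha>. pdiff_pow \<alpha> h) g"

text \<open>Substitution of polynomials for the variables; it provides the elements \<open>g(\<xi>)\<close> and \<open>h(z)\<close>.\<close>

definition poly_subst :: "('v::finite \<Rightarrow> 'w cpoly) \<Rightarrow> 'v cpoly \<Rightarrow> 'w cpoly" where
  "poly_subst \<sigma> = lin_ext (\<lambda>m. \<Prod>i\<in>UNIV. \<sigma> i ^ Poly_Mapping.lookup m i)"

definition in_xi :: "'n::finite cpoly \<Rightarrow> ('n + 'n) cpoly" where
  "in_xi = poly_subst (\<lambda>i. var (Inl i))"

definition in_z :: "'n::finite cpoly \<Rightarrow> ('n + 'n) cpoly" where
  "in_z = poly_subst (\<lambda>i. var (Inr i))"

text \<open>
  The map \<open>\<E>\<close>, given on the monomials \<open>\<xi>\<^sup>\<alpha> z\<^sup>\<beta>\<close> by \<open>\<partial>\<^sup>\<alpha> z\<^sup>\<beta>\<close>. That it is the \<open>\<complex>\<close>-linear map with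
  \<open>\<E> (g(\<xi>) h(z)) = g(\<partial>) h(z)\<close> for all \<open>g\<close> and \<open>h\<close>, and the only one, is proved below.
\<close>

definition E_map :: "('n::finite + 'n) cpoly \<Rightarrow> 'n cpoly" where
  "E_map = lin_ext (\<lambda>m. pdiff_pow (Poly_Mapping.map_key Inl m) (mon (Poly_Mapping.map_key Inr m)))"

definition Theta :: "'n \<Rightarrow> ('n + 'n) cpoly \<Rightarrow> ('n + 'n) cpoly" where
  "Theta i f = var (Inl i) * f - pdiff (Inr i) f"

definition Ker_E :: "('n::finite + 'n) cpoly set" where
  "Ker_E = {f. E_map f = 0}"

definition Im_Theta :: "('n::finite + 'n) cpoly set" where
  "Im_Theta = {\<Sum>i\<in>UNIV. Theta i (f i) | f. True}"


lemma scale_add_right: "scale c (p + q) = scale c p + scale c q"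
  by (simp add: scale_def distrib_left)

lemma scale_add_left: "scale (c + d) p = scale c p + scale d p"
  by (simp add: scale_def single_add distrib_right)

lemma scale_scale: "scale c (scale d p) = scale (c * d) p"
  by (simp add: scale_def mult.assoc[symmetric] mult_single)

lemma scale_0_left [simp]: "scale 0 p = 0"
  by (simp add: scale_def)

lemma scale_0_right [simp]: "scale c 0 = 0"
  by (simp add: scale_def)

lemma scale_1 [simp]: "scale 1 p = p"
  by (simp add: scale_def)

lemma scale_sum: "scale c (sum f A) = (\<Sum>x\<in>A. scale c (f x))"
  by (simp add: scale_def sum_distrib_left)

lemma scale_mult_left: "scale c p * q = scale c (p * q)"
  by (simp add: scale_def mult.assoc)

lemma scale_mult_right: "p * scale c q = scale c (p * q)"
  by (simp add: scale_def mult.left_commute)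

lemma mon_mult: "mon (a + b) = mon a * mon b"
  by (simp add: mon_def mult_single)

lemma mon_0: "mon 0 = 1"
  by (simp add: mon_def)

lemma single_eq_scale_mon: "Poly_Mapping.single m c = scale c (mon m)"
  by (simp add: scale_def mon_def mult_single)

lemma lookup_scale: "Poly_Mapping.lookup (scale c p) m = c * Poly_Mapping.lookup p m"
  unfolding scale_def mult_map_scale_conv_mult[symmetric]
  by (simp add: Poly_Mapping.map.rep_eq when_def)

lemma lin_ext_superset:
  assumes "finite A" "Poly_Mapping.keys p \<subseteq> A"
  shows "lin_ext \<phi> p = (\<Sum>m\<in>A. scale (Poly_Mapping.lookup p m) (\<phi> m))"
  unfolding lin_ext_def
  by (rule sum.mono_neutral_left) (use assms in \<open>auto simp: in_keys_iff\<close>)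

lemma lin_ext_add: "lin_ext \<phi> (p + q) = lin_ext \<phi> p + lin_ext \<phi> q"
proof -
  let ?A = "Poly_Mapping.keys p \<union> Poly_Mapping.keys q"
  have "Poly_Mapping.keys (p + q) \<subseteq> ?A"
    by (rule keys_add)
  then show ?thesis
    by (simp add: lin_ext_superset[of ?A] lookup_add scale_add_left sum.distrib)
qed

lemma lin_ext_scale: "lin_ext \<phi> (scale c p) = scale c (lin_ext \<phi> p)"
proof -
  have "Poly_Mapping.keys (scale c p) \<subseteq> Poly_Mapping.keys p"
    by (auto simp: in_keys_iff lookup_scale)
  then show ?thesis
    by (simp add: lin_ext_superset[of "Poly_Mapping.keys p"] lookup_scale scale_sum scale_scale)
qed

lemma lin_ext_0 [simp]: "lin_ext \<phi> 0 = 0"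
  by (simp add: lin_ext_def)

lemma lin_ext_mon [simp]: "lin_ext \<phi> (mon m) = \<phi> m"
  by (simp add: lin_ext_def mon_def)

lemma cpoly_induct [case_names zero add mon]:
  assumes "P 0"
    and "\<And>p q. P p \<Longrightarrow> P q \<Longrightarrow> P (p + q)"
    and "\<And>c m. P (scale c (mon m))"
  shows "P (p :: 'v cpoly)"
proof (induction p rule: update_induct)
  case const
  then show ?case
    using assms(1) by simp
next
  case (update f a b)
  have "Poly_Mapping.update a b f = f + Poly_Mapping.single a b"
    by (rule poly_mapping_eqI)
      (use update.hyps in \<open>auto simp: lookup_update lookup_add lookup_single when_def in_keys_iff\<close>)
  then show ?case
    using assms(2,3) update.IH by (simp add: single_eq_scale_mon)
qed

lemma lin_map_eqI:
  assumes "\<And>p q. F (p + q) = F p + F q" "\<And>p q. G (p + q) = G p + G q"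
    and "\<And>c p. F (scale c p) = scale c (F p)" "\<And>c p. G (scale c p) = scale c (G p)"
    and "\<And>m. F (mon m) = G (mon m)"
  shows "F (p :: 'v cpoly) = (G p :: 'w cpoly)"
proof (induction p rule: cpoly_induct)
  case zero
  show ?case
    using assms(3)[of 0 0] assms(4)[of 0 0] by simp
qed (simp_all add: assms)

lemma pdiff_add: "pdiff v (p + q) = pdiff v p + pdiff v q"
  by (simp add: pdiff_def lin_ext_add)

lemma pdiff_scale: "pdiff v (scale c p) = scale c (pdiff v p)"
  by (simp add: pdiff_def lin_ext_scale)

lemma pdiff_mon:
  "pdiff v (mon m) = scale (of_nat (Poly_Mapping.lookup m v)) (mon (m - Poly_Mapping.single v 1))"
  by (simp add: pdiff_def)

lemma pdiff_var: "pdiff v (var w) = (if v = w then 1 else 0)"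
  by (auto simp: var_def pdiff_mon lookup_single when_def mon_0)

lemma minus_single_add:
  assumes "Poly_Mapping.lookup a v \<noteq> (0::nat)"
  shows "a - Poly_Mapping.single v 1 + b = a + b - Poly_Mapping.single v 1"
  by (rule poly_mapping_eqI) (use assms in \<open>auto simp: lookup_add lookup_minus lookup_single when_def\<close>)

lemma pdiff_mult_mon: "pdiff v (mon a * mon b) = pdiff v (mon a) * mon b + mon a * pdiff v (mon b)"
proof -
  let ?e = "Poly_Mapping.single v (1::nat)"
  let ?c = "\<lambda>m. of_nat (Poly_Mapping.lookup m v) :: complex"
  have 1: "scale (?c a) (mon (a - ?e + b)) = scale (?c a) (mon (a + b - ?e))" for a b
    using minus_single_add[of a v b] by (cases "Poly_Mapping.lookup a v = 0") auto
  have 2: "scale (?c b) (mon (a + (b - ?e))) = scale (?c b) (mon (a + b - ?e))"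
    using 1[of b a] by (simp add: add.commute)
  show ?thesis
    unfolding mon_mult[symmetric] pdiff_mon scale_mult_left scale_mult_right 1 2
    by (simp add: lookup_add scale_add_left)
qed

lemma pdiff_mult: "pdiff v (p * q) = pdiff v p * q + p * pdiff v q"
proof (rule lin_map_eqI[of "\<lambda>p. pdiff v (p * q)"])
  fix m
  show "pdiff v (mon m * q) = pdiff v (mon m) * q + mon m * pdiff v q"
    by (rule lin_map_eqI[of "\<lambda>q. pdiff v (mon m * q)"])
      (simp_all add: pdiff_mult_mon pdiff_add pdiff_scale scale_mult_right distrib_left distrib_right
        scale_add_right scale_mult_left add_ac)
qed (simp_all add: pdiff_add pdiff_scale scale_mult_left distrib_right scale_add_right add_ac)

lemma pdiff_commute: "pdiff v (pdiff w p) = pdiff w (pdiff v p)"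
proof (rule lin_map_eqI[of "\<lambda>p. pdiff v (pdiff w p)"])
  fix m :: "'a \<Rightarrow>\<^sub>0 nat"
  show "pdiff v (pdiff w (mon m)) = pdiff w (pdiff v (mon m))"
  proof (cases "v = w")
    case False
    have "m - Poly_Mapping.single w 1 - Poly_Mapping.single v 1 =
        m - Poly_Mapping.single v 1 - Poly_Mapping.single w (1::nat)"
      by (rule poly_mapping_eqI) (simp add: lookup_minus)
    with False show ?thesis
      by (simp add: pdiff_mon pdiff_scale scale_scale lookup_minus lookup_single mult.commute)
  qed simp
qed (simp_all add: pdiff_add pdiff_scale)

lemma comp_fun_commute_pdiff_pow:
  "comp_fun_commute (\<lambda>i. pdiff i ^^ Poly_Mapping.lookup \<alpha> i)"
proof
  fix x y :: 'a
  have 1: "pdiff x \<circ> pdiff y ^^ k = pdiff y ^^ k \<circ> pdiff x" for k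
    by (induction k) (auto simp: fun_eq_iff pdiff_commute[of x y])
  have "pdiff x ^^ j \<circ> pdiff y ^^ k = pdiff y ^^ k \<circ> pdiff x ^^ j" for j k
    by (induction j) (use 1[of k] in \<open>auto simp: fun_eq_iff\<close>)
  then show "pdiff y ^^ Poly_Mapping.lookup \<alpha> y \<circ> pdiff x ^^ Poly_Mapping.lookup \<alpha> x =
      pdiff x ^^ Poly_Mapping.lookup \<alpha> x \<circ> pdiff y ^^ Poly_Mapping.lookup \<alpha> y"
    by metis
qed

lemma pdiff_pow_add_scale:
  "pdiff_pow \<alpha> (p + q) = pdiff_pow \<alpha> p + pdiff_pow \<alpha> q \<and>
   pdiff_pow \<alpha> (scale c p) = scale c (pdiff_pow \<alpha> p)"
proof -
  interpret comp_fun_commute "\<lambda>i. pdiff i ^^ Poly_Mapping.lookup \<alpha> i"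
    by (rule comp_fun_commute_pdiff_pow)
  have 1: "(pdiff i ^^ k) (p + q) = (pdiff i ^^ k) p + (pdiff i ^^ k) q \<and>
      (pdiff i ^^ k) (scale c p) = scale c ((pdiff i ^^ k) p)" for i k and p q :: "'a cpoly"
    by (induction k) (simp_all add: pdiff_add pdiff_scale)
  let ?F = "\<lambda>p A. Finite_Set.fold (\<lambda>i. pdiff i ^^ Poly_Mapping.lookup \<alpha> i) p A"
  have "finite A \<Longrightarrow> ?F (p + q) A = ?F p A + ?F q A \<and> ?F (scale c p) A = scale c (?F p A)" for A
    by (induction A rule: finite_induct) (simp_all add: 1)
  then show ?thesis
    by (simp add: pdiff_pow_def)
qed

lemma poly_subst_var:
  fixes f :: "'v::finite \<Rightarrow> 'w"
  shows "poly_subst (\<lambda>i. var (f i)) (mon m) =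
    mon (\<Sum>i\<in>UNIV. Poly_Mapping.single (f i) (Poly_Mapping.lookup m i))"
proof -
  have 1: "var w ^ k = mon (Poly_Mapping.single w k)" for w :: 'w and k
    by (induction k) (simp_all add: mon_0 var_def mon_mult[symmetric] single_add[symmetric])
  have "finite A \<Longrightarrow> (\<Prod>i\<in>A. mon (g i)) = (mon (\<Sum>i\<in>A. g i) :: 'w cpoly)" for g and A :: "'v set"
    by (induction A rule: finite_induct) (simp_all add: mon_0 mon_mult)
  then show ?thesis
    by (simp add: poly_subst_def 1)
qed

lemma in_xi_linear: "in_xi (p + q) = in_xi p + in_xi q" "in_xi (scale c p) = scale c (in_xi p)"
  by (simp_all add: in_xi_def poly_subst_def lin_ext_add lin_ext_scale)

lemma in_z_linear: "in_z (p + q) = in_z p + in_z q" "in_z (scale c p) = scale c (in_z p)"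
  by (simp_all add: in_z_def poly_subst_def lin_ext_add lin_ext_scale)

lemma E_map_add: "E_map (p + q) = E_map p + E_map q"
  by (simp add: E_map_def lin_ext_add)

lemma E_map_scale: "E_map (scale c p) = scale c (E_map p)"
  by (simp add: E_map_def lin_ext_scale)

lemma E_map_mon_mult: "E_map (in_xi (mon \<alpha>) * in_z (mon \<beta>)) = pdiff_pow \<alpha> (mon \<beta>)"
proof -
  let ?a = "\<Sum>i\<in>UNIV. Poly_Mapping.single (Inl i) (Poly_Mapping.lookup \<alpha> i) :: 'a + 'a \<Rightarrow>\<^sub>0 nat"
  let ?b = "\<Sum>i\<in>UNIV. Poly_Mapping.single (Inr i) (Poly_Mapping.lookup \<beta> i) :: 'a + 'a \<Rightarrow>\<^sub>0 nat"
  have "Poly_Mapping.map_key Inl (?a + ?b) = \<alpha>" "Poly_Mapping.map_key Inr (?a + ?b) = \<beta>"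
    by (rule poly_mapping_eqI,
        simp add: map_key.rep_eq lookup_add lookup_sum lookup_single when_def)+
  then show ?thesis
    by (simp add: in_xi_def in_z_def poly_subst_var mon_mult[symmetric] E_map_def)
qed

theorem E_map_mult: "E_map (in_xi g * in_z h) = diff_op g h"
proof (rule lin_map_eqI[of "\<lambda>g. E_map (in_xi g * in_z h)" "\<lambda>g. diff_op g h"])
  fix m :: "'a \<Rightarrow>\<^sub>0 nat"
  show "E_map (in_xi (mon m) * in_z h) = diff_op (mon m) h"
    unfolding diff_op_def lin_ext_mon
    by (rule lin_map_eqI[of "\<lambda>h. E_map (in_xi (mon m) * in_z h)"])
      (simp_all add: E_map_mon_mult in_z_linear distrib_left
        scale_mult_right E_map_add E_map_scale pdiff_pow_add_scale)
qed (simp_all add: in_xi_linear diff_op_def lin_ext_add lin_ext_scale distrib_right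
      scale_mult_left E_map_add E_map_scale)

lemma mon_eq_mult:
  "mon m = in_xi (mon (Poly_Mapping.map_key Inl m)) * in_z (mon (Poly_Mapping.map_key Inr m))"
proof -
  have "m = (\<Sum>i\<in>UNIV. Poly_Mapping.single (Inl i) (Poly_Mapping.lookup (Poly_Mapping.map_key Inl m) i)) +
      (\<Sum>i\<in>UNIV. Poly_Mapping.single (Inr i) (Poly_Mapping.lookup (Poly_Mapping.map_key Inr m) i))"
    (is "_ = ?s")
  proof (rule poly_mapping_eqI)
    fix k
    show "Poly_Mapping.lookup m k = Poly_Mapping.lookup ?s k"
      by (cases k) (simp_all add: map_key.rep_eq lookup_add lookup_sum lookup_single when_def)
  qed
  then show ?thesis
    by (simp add: in_xi_def in_z_def poly_subst_var mon_mult[symmetric])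
qed

theorem E_map_unique:
  assumes "\<And>p q. F (p + q) = F p + F q" "\<And>c p. F (scale c p) = scale c (F p)"
    and "\<And>g h. F (in_xi g * in_z h) = diff_op g h"
  shows "F = E_map"
proof
  fix p
  show "F p = E_map p"
    by (rule lin_map_eqI[of F])
      (simp_all add: assms E_map_add E_map_scale E_map_mult mon_eq_mult)
qed

end

theory Submission
  imports Defs
begin

text \<open>
  The inclusion \<open>Im \<Theta> \<subseteq> Ker \<E>\<close> says that \<open>\<E> (\<xi>\<^sub>i f) = \<E> (\<partial>\<^sub>i f)\<close>. On a monomial this is
  \<open>\<partial>\<^sub>i \<partial>\<^sup>\<alpha> z\<^sup>\<beta> = \<partial>\<^sup>\<alpha> \<partial>\<^sub>i z\<^sup>\<beta>\<close>, which holds since partial derivatives commute (\<open>E_map_Theta\<close>).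

  For the converse, every \<open>f\<close> is congruent to \<open>\<E> f \<in> \<complex>[z]\<close> modulo \<open>Im \<Theta>\<close>
  (\<open>diff_in_z_E_map_in_Im_Theta\<close>), so that \<open>\<E> f = 0\<close> forces \<open>f \<in> Im \<Theta>\<close>. For the congruence it
  suffices to treat monomials, by induction on the degree in \<open>\<xi>\<close>. In degree \<open>0\<close> the map \<open>\<E>\<close> is the
  identity. In positive degree some \<open>\<xi>\<^sub>i\<close> divides the monomial, and the identity
  \<open>\<xi>\<^sub>i g = \<Theta>\<^sub>i g + \<partial>\<^sub>i g\<close> trades the factor \<open>\<xi>\<^sub>i\<close> for a derivative in \<open>z\<^sub>i\<close>, changing neither the
  class modulo \<open>Im \<Theta>\<close> nor the value of \<open>\<E>\<close>.
\<close>

lemma scale_diff_right: "scale c (p - q) = scale c p - scale c q"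
  by (simp add: scale_def right_diff_distrib)

lemma E_map_diff: "E_map (p - q) = E_map p - E_map q"
  using E_map_add[of "p - q" q] by (simp add: algebra_simps)

lemma E_map_0 [simp]: "E_map 0 = 0"
  by (simp add: E_map_def)

lemma in_z_0 [simp]: "in_z 0 = 0"
  by (simp add: in_z_def poly_subst_def)

lemma pdiff_pow_pdiff: "pdiff_pow \<alpha> (pdiff i p) = pdiff i (pdiff_pow \<alpha> p)"
proof -
  interpret comp_fun_commute "\<lambda>i. pdiff i ^^ Poly_Mapping.lookup \<alpha> i"
    by (rule comp_fun_commute_pdiff_pow)
  have 1: "(pdiff j ^^ k) (pdiff i p) = pdiff i ((pdiff j ^^ k) p)" for j k p
    by (induction k) (simp_all add: pdiff_commute[of j i])
  have "Finite_Set.fold (\<lambda>i. pdiff i ^^ Poly_Mapping.lookup \<alpha> i) (pdiff i p) A =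
      pdiff i (Finite_Set.fold (\<lambda>i. pdiff i ^^ Poly_Mapping.lookup \<alpha> i) p A)" if "finite A" for A
    using that by (induction A rule: finite_induct) (simp_all add: 1)
  then show ?thesis
    by (simp add: pdiff_pow_def)
qed

lemma pdiff_pow_single_add:
  "pdiff_pow (Poly_Mapping.single i 1 + \<alpha>) p = pdiff i (pdiff_pow \<alpha> p)"
proof -
  let ?f = "\<lambda>\<alpha> i. pdiff i ^^ Poly_Mapping.lookup \<alpha> i"
  let ?\<beta> = "Poly_Mapping.single i 1 + \<alpha>"
  interpret A: comp_fun_commute "?f \<alpha>"
    by (rule comp_fun_commute_pdiff_pow)
  interpret B: comp_fun_commute "?f ?\<beta>"
    by (rule comp_fun_commute_pdiff_pow)
  have 1: "(pdiff j ^^ k) (pdiff i p) = pdiff i ((pdiff j ^^ k) p)" for j k p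
    by (induction k) (simp_all add: pdiff_commute[of j i])
  have "Finite_Set.fold (?f ?\<beta>) p A =
      (if i \<in> A then pdiff i (Finite_Set.fold (?f \<alpha>) p A) else Finite_Set.fold (?f \<alpha>) p A)"
    if "finite A" for A
    using that
  proof (induction A rule: finite_induct)
    case (insert x F)
    have "?f ?\<beta> x q = (if x = i then pdiff i (?f \<alpha> x q) else ?f \<alpha> x q)" for q
      by (simp add: lookup_add lookup_single)
    moreover have "Finite_Set.fold (?f ?\<beta>) p (insert x F) = ?f ?\<beta> x (Finite_Set.fold (?f ?\<beta>) p F)"
      using insert by (intro B.fold_insert)
    ultimately show ?case
      using insert by (auto simp only: A.fold_insert insert.IH insert_iff 1 split: if_splits)
  qed simp
  then show ?thesis
    by (simp add: pdiff_pow_def)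
qed

lemma pdiff_pow_0: "pdiff_pow 0 p = p"
proof -
  interpret comp_fun_commute "\<lambda>i. pdiff i ^^ Poly_Mapping.lookup 0 i"
    by (rule comp_fun_commute_pdiff_pow)
  have "Finite_Set.fold (\<lambda>i. pdiff i ^^ Poly_Mapping.lookup 0 i) p A = p" if "finite A" for A
    using that
  proof (induction A rule: finite_induct)
    case (insert x F)
    then show ?case
      by (subst fold_insert) (simp_all add: id_def)
  qed simp
  then show ?thesis
    by (simp add: pdiff_pow_def)
qed

lemma E_map_Theta: "E_map (Theta i f) = 0"
proof -
  have "E_map (var (Inl i) * f) = E_map (pdiff (Inr i) f)"
  proof (rule lin_map_eqI[of "\<lambda>f. E_map (var (Inl i) * f)"])
    fix m :: "'a + 'a \<Rightarrow>\<^sub>0 nat"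
    let ?\<alpha> = "Poly_Mapping.map_key Inl m" and ?\<beta> = "Poly_Mapping.map_key Inr m"
    let ?x = "Poly_Mapping.single (Inl i) 1 + m" and ?d = "m - Poly_Mapping.single (Inr i) 1"
    have key: "Poly_Mapping.map_key Inl ?x = Poly_Mapping.single i 1 + ?\<alpha>"
      "Poly_Mapping.map_key Inr ?x = ?\<beta>"
      "Poly_Mapping.map_key Inl ?d = ?\<alpha>"
      "Poly_Mapping.map_key Inr ?d = ?\<beta> - Poly_Mapping.single i 1"
      by (rule poly_mapping_eqI,
          simp add: map_key.rep_eq lookup_add lookup_minus lookup_single when_def)+
    have "E_map (var (Inl i) * mon m) = pdiff i (pdiff_pow ?\<alpha> (mon ?\<beta>))"
      by (simp only: var_def mon_mult[symmetric] E_map_def lin_ext_mon key pdiff_pow_single_add)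
    also have "\<dots> = pdiff_pow ?\<alpha> (pdiff i (mon ?\<beta>))"
      by (simp only: pdiff_pow_pdiff)
    also have "\<dots> = scale (of_nat (Poly_Mapping.lookup m (Inr i))) (E_map (mon ?d))"
      by (simp only: pdiff_mon E_map_def lin_ext_mon key) (simp add: map_key.rep_eq pdiff_pow_add_scale)
    also have "\<dots> = E_map (pdiff (Inr i) (mon m))"
      by (simp only: pdiff_mon E_map_scale)
    finally show "E_map (var (Inl i) * mon m) = E_map (pdiff (Inr i) (mon m))" .
  qed (simp_all add: distrib_left scale_mult_right pdiff_add pdiff_scale E_map_add E_map_scale)
  then show ?thesis
    by (simp add: Theta_def E_map_diff)
qed

lemma Theta_add: "Theta i (f + g) = Theta i f + Theta i g"
  by (simp add: Theta_def pdiff_add algebra_simps)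

lemma Theta_scale: "Theta i (scale c f) = scale c (Theta i f)"
  by (simp add: Theta_def pdiff_scale scale_mult_right scale_diff_right)

lemma Theta_0 [simp]: "Theta i 0 = 0"
  using Theta_scale[of i 0 0] by simp

lemma Im_Theta_add:
  assumes "p \<in> Im_Theta" "q \<in> Im_Theta"
  shows "p + q \<in> Im_Theta"
proof -
  from assms obtain f g where "p = (\<Sum>i\<in>UNIV. Theta i (f i))" "q = (\<Sum>i\<in>UNIV. Theta i (g i))"
    by (auto simp: Im_Theta_def)
  then have "p + q = (\<Sum>i\<in>UNIV. Theta i (f i + g i))"
    by (simp add: Theta_add sum.distrib)
  then show ?thesis
    unfolding Im_Theta_def by (intro CollectI exI[of _ "\<lambda>i. f i + g i"]) simp
qed

lemma Im_Theta_scale: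
  assumes "p \<in> Im_Theta"
  shows "scale c p \<in> Im_Theta"
proof -
  from assms obtain f where "p = (\<Sum>i\<in>UNIV. Theta i (f i))"
    by (auto simp: Im_Theta_def)
  then have "scale c p = (\<Sum>i\<in>UNIV. Theta i (scale c (f i)))"
    by (simp add: Theta_scale scale_sum)
  then show ?thesis
    unfolding Im_Theta_def by (intro CollectI exI[of _ "\<lambda>i. scale c (f i)"]) simp
qed

lemma Im_Theta_0: "0 \<in> Im_Theta"
  unfolding Im_Theta_def by (intro CollectI exI[of _ "\<lambda>_. 0"]) simp

lemma Theta_in_Im_Theta: "Theta i g \<in> Im_Theta"
proof -
  have "(\<Sum>j\<in>UNIV. Theta j (if j = i then g else 0)) = (\<Sum>j\<in>UNIV. if j = i then Theta j g else 0)"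
    by (rule sum.cong) auto
  then have "Theta i g = (\<Sum>j\<in>UNIV. Theta j (if j = i then g else 0))"
    by simp
  then show ?thesis
    unfolding Im_Theta_def by (intro CollectI exI[of _ "\<lambda>j. if j = i then g else 0"]) simp
qed

lemma in_z_E_map_mon:
  assumes "Poly_Mapping.map_key Inl m = 0"
  shows "in_z (E_map (mon m)) = mon m"
proof -
  have "in_xi (mon 0) = (1 :: ('a + 'a) cpoly)"
    unfolding in_xi_def poly_subst_var by (simp add: mon_0)
  then have "mon m = in_z (mon (Poly_Mapping.map_key Inr m))"
    using mon_eq_mult[of m] assms by simp
  moreover have "E_map (mon m) = mon (Poly_Mapping.map_key Inr m)"
    by (simp add: E_map_def assms pdiff_pow_0)
  ultimately show ?thesis
    by simp
qed

lemma mon_diff_in_z_E_map_in_Im_Theta: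
  fixes m :: "'n::finite + 'n \<Rightarrow>\<^sub>0 nat"
  shows "mon m - in_z (E_map (mon m)) \<in> Im_Theta"
proof (induction "\<Sum>i\<in>UNIV. Poly_Mapping.lookup m (Inl i)" arbitrary: m rule: less_induct)
  case less
  show ?case
  proof (cases "Poly_Mapping.map_key Inl m = 0")
    case True
    then show ?thesis
      by (simp add: in_z_E_map_mon Im_Theta_0)
  next
    case False
    then obtain i where i: "Poly_Mapping.lookup m (Inl i) \<noteq> 0"
      by (auto simp: poly_mapping_eq_iff fun_eq_iff map_key.rep_eq)
    define m' where "m' = m - Poly_Mapping.single (Inl i) 1"
    \<comment> \<open>If \<open>z\<^sub>i\<close> does not occur in \<open>m'\<close>, the exponent in \<open>d\<close> is truncated, but then \<open>c = 0\<close>.\<close>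
    define d where "d = m' - Poly_Mapping.single (Inr i) 1"
    define c :: complex where "c = of_nat (Poly_Mapping.lookup m' (Inr i))"
    have "m = Poly_Mapping.single (Inl i) 1 + m'"
      unfolding m'_def using i
      by (intro poly_mapping_eqI) (auto simp: lookup_add lookup_minus lookup_single when_def)
    then have m: "mon m = Theta i (mon m') + scale c (mon d)"
      by (simp add: Theta_def var_def mon_mult pdiff_mon c_def d_def)
    have "(\<Sum>j\<in>UNIV. Poly_Mapping.lookup d (Inl j)) < (\<Sum>j\<in>UNIV. Poly_Mapping.lookup m (Inl j))"
      using i by (intro sum_strict_mono_ex1)
        (auto simp: d_def m'_def lookup_minus lookup_single when_def intro!: exI[of _ i])
    then have d: "mon d - in_z (E_map (mon d)) \<in> Im_Theta"
      by (rule less)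
    have "mon m - in_z (E_map (mon m)) = Theta i (mon m') + scale c (mon d - in_z (E_map (mon d)))"
      by (simp add: m E_map_add E_map_scale E_map_Theta in_z_linear scale_diff_right)
    with d show ?thesis
      by (simp add: Im_Theta_add Theta_in_Im_Theta Im_Theta_scale)
  qed
qed

lemma diff_in_z_E_map_in_Im_Theta: "f - in_z (E_map f) \<in> Im_Theta"
proof (induction f rule: cpoly_induct)
  case zero
  show ?case
    by (simp add: Im_Theta_0)
next
  case (add p q)
  have "p + q - in_z (E_map (p + q)) = (p - in_z (E_map p)) + (q - in_z (E_map q))"
    by (simp add: E_map_add in_z_linear)
  with add show ?case
    by (simp only: Im_Theta_add)
next
  case (mon c m)
  have "scale c (mon m) - in_z (E_map (scale c (mon m))) = scale c (mon m - in_z (E_map (mon m)))"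
    by (simp add: E_map_scale in_z_linear scale_diff_right)
  then show ?case
    by (simp only: Im_Theta_scale mon_diff_in_z_E_map_in_Im_Theta)
qed

theorem theorem3p1:
  shows "(Ker_E :: ('n::finite + 'n) cpoly set) = Im_Theta"
proof
  show "(Ker_E :: ('n + 'n) cpoly set) \<subseteq> Im_Theta"
  proof
    fix f :: "('n + 'n) cpoly"
    assume "f \<in> Ker_E"
    then have "E_map f = 0"
      by (simp add: Ker_E_def)
    then show "f \<in> Im_Theta"
      using diff_in_z_E_map_in_Im_Theta[of f] by simp
  qed
  have "E_map (\<Sum>i\<in>A. Theta i (f i)) = 0" for f :: "'n \<Rightarrow> ('n + 'n) cpoly" and A
    by (induction A rule: infinite_finite_induct)
      (simp_all add: E_map_add E_map_Theta)
  then show "(Im_Theta :: ('n + 'n) cpoly set) \<subseteq> Ker_E"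
    by (auto simp: Im_Theta_def Ker_E_def)
qed

end
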